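(* Let $(X,T)$ be a topological flow with induced flow $(E(X),T)$ on its enveloping semigroup. If $(X,T)$ is equicontinuous, then $(E(X),T)$ is equicontinuous. If $(X,T)$ is point transitive, then the converse also holds: if $(E(X),T)$ is equicontinuous, then $(X,T)$ is equicontinuous.
   Context: A (topological) flow $(X,T)$ consists of a compact Hausdorff space $X$, a topological group $T$, and a continuous map $\pi:T\times X\to X$, written $\pi(t,x)=tx$, with $(st)x=s(tx)$ and such that each $\pi^t:X\to X$, $\pi^t(x)=tx$, is a homeomorphism (so the identity of $T$ acts as the identity map). Standing assumption: the space $X$ of the given flow has no isolated points (this is not required of $E(X)$). The enveloping semigroup is $E(X)=\overline{\{\pi^t: t\in T\}}\subseteq X^X$, the closure being taken in the product topology; $T$ acts on the compact Hausdorff space $E(X)$ by $t\cdot p=\pi^t\circ p$, giving the induced flow $(E(X),T)$. The notions below apply to any compact Hausdorff space $Y$ with a continuous action of $T$, where $\mathcal{U}_Y$ denotes the unique uniformity compatible with the topology of $Y$. $(Y,T)$ is equicontinuous at $x\in Y$ if for each $V\in\mathcal{U}_Y$ there is $U\in\mathcal{U}_Y$ such that $(x,y)\in U$ implies $(tx,ty)\in V$ for all $t\in T$; $(Y,T)$ is equicontinuous if it is equicontinuous at every point. $(Y,T)$ is point transitive if some $x\in Y$ has dense orbit $Tx=\{tx:t\in T\}$. *)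

theory Defs
  imports "HOL-Analysis.Analysis"
begin

section \<open>The uniformity of a compact Hausdorff space\<close>

text \<open>The library class \<open>uniform_space\<close> equips whole types with a uniformity; the enveloping
  semigroup is a proper subset of a function type, so uniformities (given by their sets of
  entourages) are needed on arbitrary carrier sets.\<close>

definition uniform_structure :: "'a set \<Rightarrow> ('a \<times> 'a) set set \<Rightarrow> bool" where
  "uniform_structure S \<U> \<longleftrightarrow>
     \<U> \<noteq> {} \<and>
     (\<forall>U\<in>\<U>. Id_on S \<subseteq> U \<and> U \<subseteq> S \<times> S \<and> U\<inverse> \<in> \<U> \<and> (\<exists>W\<in>\<U>. W O W \<subseteq> U)) \<and>
     (\<forall>U\<in>\<U>. \<forall>V\<in>\<U>. U \<inter> V \<in> \<U>) \<and>
     (\<forall>U\<in>\<U>. \<forall>V. U \<subseteq> V \<and> V \<subseteq> S \<times> S \<longrightarrow> V \<in> \<U>)"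

definition compatible_uniformity :: "'a topology \<Rightarrow> ('a \<times> 'a) set set \<Rightarrow> bool" where
  "compatible_uniformity Y \<U> \<longleftrightarrow>
     uniform_structure (topspace Y) \<U> \<and>
     (\<forall>S. openin Y S \<longleftrightarrow> S \<subseteq> topspace Y \<and> (\<forall>x\<in>S. \<exists>U\<in>\<U>. U `` {x} \<subseteq> S))"

text \<open>Only meaningful for compact Hausdorff spaces; see \<open>ex1_compatible_uniformity\<close> below.\<close>

definition uniformity_of :: "'a topology \<Rightarrow> ('a \<times> 'a) set set" where
  "uniformity_of Y = (THE \<U>. compatible_uniformity Y \<U>)"


section \<open>Flows\<close>

text \<open>The acting group is a type of class \<open>topological_group_add\<close>. It is written additively but
  is not assumed to be commutative, and its topology is not assumed to be Hausdorff.\<close>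

definition topological_flow ::
    "'y topology \<Rightarrow> ('t::topological_group_add \<Rightarrow> 'y \<Rightarrow> 'y) \<Rightarrow> bool" where
  "topological_flow Y act \<longleftrightarrow>
     compact_space Y \<and> Hausdorff_space Y \<and>
     continuous_map (prod_topology euclidean Y) Y (\<lambda>(t, x). act t x) \<and>
     (\<forall>s t. \<forall>x\<in>topspace Y. act (s + t) x = act s (act t x)) \<and>
     (\<forall>t. homeomorphic_map Y Y (act t))"

definition equicontinuous_at :: "'y topology \<Rightarrow> ('t \<Rightarrow> 'y \<Rightarrow> 'y) \<Rightarrow> 'y \<Rightarrow> bool" where
  "equicontinuous_at Y act x \<longleftrightarrow>
     (\<forall>V\<in>uniformity_of Y. \<exists>U\<in>uniformity_of Y.
        \<forall>y. (x, y) \<in> U \<longrightarrow> (\<forall>t. (act t x, act t y) \<in> V))"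

definition equicontinuous_flow :: "'y topology \<Rightarrow> ('t \<Rightarrow> 'y \<Rightarrow> 'y) \<Rightarrow> bool" where
  "equicontinuous_flow Y act \<longleftrightarrow> (\<forall>x\<in>topspace Y. equicontinuous_at Y act x)"

definition point_transitive :: "'y topology \<Rightarrow> ('t \<Rightarrow> 'y \<Rightarrow> 'y) \<Rightarrow> bool" where
  "point_transitive Y act \<longleftrightarrow>
     (\<exists>x\<in>topspace Y. Y closure_of (range (\<lambda>t. act t x)) = topspace Y)"


section \<open>The enveloping semigroup\<close>

text \<open>Self-maps of the space are represented by functions that are \<open>undefined\<close> outside
  \<open>topspace X\<close>, which is the representation used by \<open>product_topology\<close>.\<close>

definition enveloping_semigroup :: "'x topology \<Rightarrow> ('t \<Rightarrow> 'x \<Rightarrow> 'x) \<Rightarrow> ('x \<Rightarrow> 'x) set" where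
  "enveloping_semigroup X act =
     product_topology (\<lambda>_. X) (topspace X) closure_of (range (\<lambda>t. restrict (act t) (topspace X)))"

definition enveloping_space :: "'x topology \<Rightarrow> ('t \<Rightarrow> 'x \<Rightarrow> 'x) \<Rightarrow> ('x \<Rightarrow> 'x) topology" where
  "enveloping_space X act =
     subtopology (product_topology (\<lambda>_. X) (topspace X)) (enveloping_semigroup X act)"

definition enveloping_action :: "'x topology \<Rightarrow> ('t \<Rightarrow> 'x \<Rightarrow> 'x) \<Rightarrow> 't \<Rightarrow> ('x \<Rightarrow> 'x) \<Rightarrow> ('x \<Rightarrow> 'x)" where
  "enveloping_action X act t p = compose (topspace X) (act t) p"


section \<open>Well-definedness\<close>

lemma uniform_structure_diag: "uniform_structure S \<U> \<Longrightarrow> U \<in> \<U> \<Longrightarrow> x \<in> S \<Longrightarrow> (x, x) \<in> U"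
  unfolding uniform_structure_def by (meson Id_onI subsetD)

lemma uniform_structure_half:
  assumes "uniform_structure S \<U>" "U \<in> \<U>"
  obtains W where "W \<in> \<U>" "W O W \<subseteq> U" "W\<inverse> = W"
proof -
  obtain V where V: "V \<in> \<U>" "V O V \<subseteq> U"
    using assms unfolding uniform_structure_def by meson
  with assms have "V \<inter> V\<inverse> \<in> \<U>"
    unfolding uniform_structure_def by meson
  moreover have "(V \<inter> V\<inverse>) O (V \<inter> V\<inverse>) \<subseteq> U" "(V \<inter> V\<inverse>)\<inverse> = V \<inter> V\<inverse>"
    using V by auto
  ultimately show thesis using that by blast
qed

lemma compatible_uniformity_nbhd:
  assumes c: "compatible_uniformity Y \<U>" and "U \<in> \<U>" "x \<in> topspace Y"
  obtains P where "openin Y P" "x \<in> P" "P \<subseteq> U `` {x}"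
proof -
  have u: "uniform_structure (topspace Y) \<U>"
    using c by (simp add: compatible_uniformity_def)
  let ?P = "{y \<in> topspace Y. \<exists>V\<in>\<U>. V `` {y} \<subseteq> U `` {x}}"
  have "\<exists>W\<in>\<U>. W `` {y} \<subseteq> ?P" if y: "y \<in> ?P" for y
  proof -
    obtain V where V: "V \<in> \<U>" "V `` {y} \<subseteq> U `` {x}" using y by auto
    obtain W where W: "W \<in> \<U>" "W O W \<subseteq> V" by (rule uniform_structure_half[OF u V(1)])
    have "W \<subseteq> topspace Y \<times> topspace Y" using u W(1) unfolding uniform_structure_def by meson
    moreover have "W `` {z} \<subseteq> U `` {x}" if "(y, z) \<in> W" for z
      using that W(2) V(2) by blast
    ultimately have "W `` {y} \<subseteq> ?P" using W(1) by blast
    with W(1) show ?thesis by blast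
  qed
  then have "openin Y ?P" using c unfolding compatible_uniformity_def by blast
  moreover have "x \<in> ?P" using assms by blast
  moreover have "?P \<subseteq> U `` {x}" using uniform_structure_diag[OF u] by blast
  ultimately show thesis using that by blast
qed

lemma compatible_uniformity_eq:
  assumes comp: "compact_space Y" and c: "compatible_uniformity Y \<U>"
  shows "\<U> = {U. U \<subseteq> topspace Y \<times> topspace Y \<and>
                 (\<exists>M. openin (prod_topology Y Y) M \<and> Id_on (topspace Y) \<subseteq> M \<and> M \<subseteq> U)}"
    (is "_ = ?N")
proof
  have u: "uniform_structure (topspace Y) \<U>"
    using c by (simp add: compatible_uniformity_def)
  show "\<U> \<subseteq> ?N"
  proof
    fix U assume U: "U \<in> \<U>"
    obtain W where W: "W \<in> \<U>" "W O W \<subseteq> U" "W\<inverse> = W" by (rule uniform_structure_half[OF u U])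
    have "\<forall>x\<in>topspace Y. \<exists>P. openin Y P \<and> x \<in> P \<and> P \<subseteq> W `` {x}"
      using compatible_uniformity_nbhd[OF c W(1)] by metis
    then obtain P where P: "\<And>x. x \<in> topspace Y \<Longrightarrow> openin Y (P x) \<and> x \<in> P x \<and> P x \<subseteq> W `` {x}"
      by metis
    let ?M = "\<Union>x\<in>topspace Y. P x \<times> P x"
    have "openin (prod_topology Y Y) ?M"
      using P by (intro openin_Union) (auto simp: openin_prod_Times_iff)
    moreover have "Id_on (topspace Y) \<subseteq> ?M" using P by blast
    moreover have "?M \<subseteq> U"
    proof clarify
      fix x y z assume "x \<in> topspace Y" "y \<in> P x" "z \<in> P x"
      then have "(x, y) \<in> W" "(x, z) \<in> W" using P by blast+
      then have "(y, x) \<in> W" using W(3) by blast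
      then show "(y, z) \<in> U" using W(2) \<open>(x, z) \<in> W\<close> by blast
    qed
    moreover have "U \<subseteq> topspace Y \<times> topspace Y"
      using u U unfolding uniform_structure_def by meson
    ultimately show "U \<in> ?N" by (intro CollectI conjI exI[of _ ?M])
  qed
  show "?N \<subseteq> \<U>"
  proof clarify
    fix U M assume U: "U \<subseteq> topspace Y \<times> topspace Y" and M: "openin (prod_topology Y Y) M"
      "Id_on (topspace Y) \<subseteq> M" "M \<subseteq> U"
    have "\<exists>P V. openin Y P \<and> x \<in> P \<and> V \<in> \<U> \<and> (\<forall>y\<in>P. \<forall>z. (y, z) \<in> V \<longrightarrow> (y, z) \<in> M)"
      if x: "x \<in> topspace Y" for x
    proof -
      have "(x, x) \<in> M" using M(2) x by blast
      then obtain A B where AB: "openin Y A" "openin Y B" "x \<in> A" "x \<in> B" "A \<times> B \<subseteq> M"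
        using M(1) unfolding openin_prod_topology_alt by meson
      then have "openin Y (A \<inter> B)" "x \<in> A \<inter> B" by auto
      then obtain V where V: "V \<in> \<U>" "V `` {x} \<subseteq> A \<inter> B"
        using c unfolding compatible_uniformity_def by meson
      obtain W where W: "W \<in> \<U>" "W O W \<subseteq> V" by (rule uniform_structure_half[OF u V(1)])
      obtain P where P: "openin Y P" "x \<in> P" "P \<subseteq> W `` {x}"
        by (rule compatible_uniformity_nbhd[OF c W(1) x])
      have "(y, z) \<in> M" if "y \<in> P" "(y, z) \<in> W" for y z
      proof -
        have "(x, y) \<in> W" using P that by blast
        moreover have "(y, y) \<in> W"
          using uniform_structure_diag[OF u W(1)] openin_subset[OF P(1)] that by blast
        ultimately have "(x, y) \<in> V" "(x, z) \<in> V" using W(2) that by blast+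
        then show ?thesis using V(2) AB(5) by blast
      qed
      then have "\<forall>y\<in>P. \<forall>z. (y, z) \<in> W \<longrightarrow> (y, z) \<in> M" by simp
      then show ?thesis using P(1,2) W(1) by (intro exI[of _ P] exI[of _ W] conjI)
    qed
    then obtain P V where PV: "\<And>x. x \<in> topspace Y \<Longrightarrow>
        openin Y (P x) \<and> x \<in> P x \<and> V x \<in> \<U> \<and> (\<forall>y\<in>P x. \<forall>z. (y, z) \<in> V x \<longrightarrow> (y, z) \<in> M)"
      by metis
    have "\<forall>U\<in>P ` topspace Y. openin Y U" using PV by simp
    moreover have "topspace Y \<subseteq> \<Union> (P ` topspace Y)" using PV by force
    ultimately
    obtain \<F> where \<F>: "finite \<F>" "\<F> \<subseteq> P ` topspace Y" "topspace Y \<subseteq> \<Union>\<F>"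
      using comp unfolding compact_space_alt by meson
    obtain F where F: "F \<subseteq> topspace Y" "finite F" "\<F> = P ` F"
      using finite_subset_image[OF \<F>(1,2)] by (elim exE conjE)
    have "\<exists>W\<in>\<U>. \<forall>x\<in>F. W \<subseteq> V x" using F(2,1)
    proof (induction F)
      case empty
      have "\<U> \<noteq> {}" using u unfolding uniform_structure_def by simp
      then show ?case by auto
    next
      case (insert x F)
      then obtain W where W: "W \<in> \<U>" "\<forall>x\<in>F. W \<subseteq> V x" by blast
      moreover have "V x \<in> \<U>" using PV insert.prems by simp
      ultimately have "W \<inter> V x \<in> \<U>" using u unfolding uniform_structure_def by meson
      then show ?case using W(2) by (intro bexI[of _ "W \<inter> V x"]) auto
    qed
    then obtain W where W: "W \<in> \<U>" "\<forall>x\<in>F. W \<subseteq> V x" by blast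
    have "W \<subseteq> U"
    proof clarify
      fix y z assume yz: "(y, z) \<in> W"
      have "W \<subseteq> topspace Y \<times> topspace Y" using u W(1) unfolding uniform_structure_def by meson
      with yz have "y \<in> topspace Y" by blast
      then obtain x where x: "x \<in> F" "y \<in> P x" using \<F>(3) F(3) by auto
      then have "(y, z) \<in> V x" using W(2) yz by (meson subsetD)
      moreover have "x \<in> topspace Y" using F(1) x(1) by (rule subsetD)
      ultimately have "(y, z) \<in> M" using PV x(2) by simp
      then show "(y, z) \<in> U" using M(3) by (meson subsetD)
    qed
    then show "U \<in> \<U>" using u W(1) U unfolding uniform_structure_def by meson
  qed
qed

lemma diagonal_nbhd_half:
  assumes comp: "compact_space Y" and haus: "Hausdorff_space Y"
    and M: "openin (prod_topology Y Y) M" "Id_on (topspace Y) \<subseteq> M"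
  obtains W where "openin (prod_topology Y Y) W" "Id_on (topspace Y) \<subseteq> W" "W O W \<subseteq> M"
proof -
  let ?S = "topspace Y" and ?Q = "prod_topology Y Y"
  let ?K = "?S \<times> ?S - M"
  have reg: "neighbourhood_base_of (closedin Y) Y"
    using compact_Hausdorff_imp_regular_space[OF comp haus]
    by (simp add: neighbourhood_base_of_closedin)
  have "\<exists>P W. openin ?Q P \<and> p \<in> P \<and> openin ?Q W \<and> Id_on ?S \<subseteq> W \<and> W O W \<inter> P = {}"
    if p: "p \<in> ?K" for p
  proof -
    obtain a b where ab: "p = (a, b)" "a \<in> ?S" "b \<in> ?S" "a \<noteq> b"
      using p M(2) by (cases p) (auto simp: Id_on_def)
    then obtain A B where AB: "openin Y A" "openin Y B" "a \<in> A" "b \<in> B" "A \<inter> B = {}"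
      using haus unfolding Hausdorff_space_def disjnt_def by metis
    obtain A1 C where A1: "openin Y A1" "closedin Y C" "a \<in> A1" "A1 \<subseteq> C" "C \<subseteq> A"
      using reg AB unfolding neighbourhood_base_of by metis
    obtain B1 D where B1: "openin Y B1" "closedin Y D" "b \<in> B1" "B1 \<subseteq> D" "D \<subseteq> B"
      using reg AB unfolding neighbourhood_base_of by metis
    let ?W = "?S \<times> ?S - (C \<times> (?S - A) \<union> (?S - B) \<times> D)"
    have "closedin ?Q (C \<times> (?S - A) \<union> (?S - B) \<times> D)"
      using A1 B1 AB by (intro closedin_Un) (auto simp: closedin_prod_Times_iff)
    then have "openin ?Q ?W"
      using openin_diff[OF openin_topspace, of ?Q] by simp
    moreover have "Id_on ?S \<subseteq> ?W" using A1 B1 by auto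
    moreover have "openin ?Q (A1 \<times> B1)" using A1 B1 by (simp add: openin_prod_Times_iff)
    moreover have "?W O ?W \<inter> (A1 \<times> B1) = {}"
    proof -
      have False if "(x, y) \<in> ?W" "(y, z) \<in> ?W" "x \<in> A1" "z \<in> B1" for x y z
      proof -
        have "y \<in> A" "y \<in> B" using that A1(4) B1(4) by auto
        then show False using AB(5) by blast
      qed
      then show ?thesis by (auto simp: relcomp_unfold)
    qed
    moreover have "p \<in> A1 \<times> B1" using ab(1) A1(3) B1(3) by simp
    ultimately show ?thesis by (intro exI[of _ "A1 \<times> B1"] exI[of _ ?W] conjI)
  qed
  then obtain P W where PW: "\<And>p. p \<in> ?K \<Longrightarrow>
      openin ?Q (P p) \<and> p \<in> P p \<and> openin ?Q (W p) \<and> Id_on ?S \<subseteq> W p \<and> W p O W p \<inter> P p = {}"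
    by metis
  have "compact_space ?Q" using comp by (simp add: compact_space_prod_topology)
  moreover have "closedin ?Q ?K" using M(1) closedin_diff[OF closedin_topspace, of ?Q] by simp
  ultimately have "compactin ?Q ?K" by (rule closedin_compact_space)
  moreover have "\<forall>U\<in>P ` ?K. openin ?Q U" using PW by simp
  moreover have "?K \<subseteq> \<Union> (P ` ?K)" using PW by (meson UN_I subsetI)
  ultimately obtain \<F> where \<F>: "finite \<F>" "\<F> \<subseteq> P ` ?K" "?K \<subseteq> \<Union>\<F>"
    unfolding compactin_def by meson
  obtain F where F: "F \<subseteq> ?K" "finite F" "\<F> = P ` F"
    using finite_subset_image[OF \<F>(1,2)] by (elim exE conjE)
  have "\<exists>V. openin ?Q V \<and> Id_on ?S \<subseteq> V \<and> (\<forall>p\<in>F. V \<subseteq> W p)" using F(2,1)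
  proof (induction F)
    case empty
    have "openin ?Q (?S \<times> ?S)" by (simp add: openin_prod_Times_iff)
    then show ?case by (intro exI[of _ "?S \<times> ?S"]) auto
  next
    case (insert p F)
    then obtain V where V: "openin ?Q V" "Id_on ?S \<subseteq> V" "\<forall>p\<in>F. V \<subseteq> W p" by blast
    moreover have "openin ?Q (W p)" "Id_on ?S \<subseteq> W p"
      using PW[of p] insert.prems by (meson insert_subset)+
    ultimately show ?case by (intro exI[of _ "V \<inter> W p"]) auto
  qed
  then obtain V where V: "openin ?Q V" "Id_on ?S \<subseteq> V" "\<forall>p\<in>F. V \<subseteq> W p" by blast
  have "V O V \<subseteq> M"
  proof
    fix q assume q: "q \<in> V O V"
    have "V \<subseteq> ?S \<times> ?S" using openin_subset[OF V(1)] by simp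
    then have "q \<in> ?S \<times> ?S" using q by blast
    moreover have False if qK: "q \<in> ?K"
    proof -
      obtain p where p: "p \<in> F" "q \<in> P p" using subsetD[OF \<F>(3) qK] F(3) by auto
      then have "V \<subseteq> W p" using V(3) by simp
      then have "q \<in> W p O W p" using q by (meson relcomp_mono subsetD)
      moreover have "W p O W p \<inter> P p = {}" using PW[OF subsetD[OF F(1) p(1)]] by simp
      ultimately show False using p(2) by (meson disjoint_iff)
    qed
    ultimately show "q \<in> M" by blast
  qed
  with V show thesis using that by blast
qed

lemma compatible_uniformity_diagonal_nbhds:
  assumes comp: "compact_space Y" and haus: "Hausdorff_space Y"
  shows "compatible_uniformity Y {U. U \<subseteq> topspace Y \<times> topspace Y \<and>
           (\<exists>M. openin (prod_topology Y Y) M \<and> Id_on (topspace Y) \<subseteq> M \<and> M \<subseteq> U)}"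
    (is "compatible_uniformity Y ?N")
proof -
  let ?S = "topspace Y" and ?Q = "prod_topology Y Y"
  have NI: "U \<in> ?N" if "openin ?Q M" "Id_on ?S \<subseteq> M" "M \<subseteq> U" "U \<subseteq> ?S \<times> ?S" for U M
    using that by blast
  have "openin ?Q (?S \<times> ?S)" by (simp add: openin_prod_Times_iff)
  then have top: "?S \<times> ?S \<in> ?N" by (rule NI) auto
  have conv: "U\<inverse> \<in> ?N" if U: "U \<in> ?N" for U
  proof -
    obtain M where M: "openin ?Q M" "Id_on ?S \<subseteq> M" "M \<subseteq> U" using U by blast
    have "\<exists>A B. openin Y A \<and> openin Y B \<and> x \<in> A \<and> y \<in> B \<and> A \<times> B \<subseteq> M\<inverse>"
      if xy: "(x, y) \<in> M\<inverse>" for x y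
    proof -
      have "(y, x) \<in> M" using xy by simp
      then obtain B A where "openin Y B" "openin Y A" "y \<in> B" "x \<in> A" "B \<times> A \<subseteq> M"
        using M(1) unfolding openin_prod_topology_alt by meson
      then show ?thesis by (intro exI[of _ A] exI[of _ B]) auto
    qed
    then have "openin ?Q (M\<inverse>)" unfolding openin_prod_topology_alt by simp
    moreover have "Id_on ?S \<subseteq> M\<inverse>" "M\<inverse> \<subseteq> U\<inverse>" using M by auto
    ultimately show ?thesis using U by (intro NI) auto
  qed
  have half: "\<exists>W\<in>?N. W O W \<subseteq> U" if U: "U \<in> ?N" for U
  proof -
    obtain M where M: "openin ?Q M" "Id_on ?S \<subseteq> M" "M \<subseteq> U" using U by blast
    obtain W where W: "openin ?Q W" "Id_on ?S \<subseteq> W" "W O W \<subseteq> M"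
      by (rule diagonal_nbhd_half[OF comp haus M(1,2)])
    have "W \<subseteq> ?S \<times> ?S" using openin_subset[OF W(1)] by simp
    with W(1,2) have "W \<in> ?N" by (intro NI[of W]) simp_all
    then show ?thesis using W(3) M(3) by (meson subset_trans)
  qed
  have inter: "U \<inter> V \<in> ?N" if UV: "U \<in> ?N" "V \<in> ?N" for U V
  proof -
    obtain M where M: "openin ?Q M" "Id_on ?S \<subseteq> M" "M \<subseteq> U" using UV by blast
    obtain L where L: "openin ?Q L" "Id_on ?S \<subseteq> L" "L \<subseteq> V" using UV by blast
    show ?thesis using M L UV by (intro NI[of "M \<inter> L"]) auto
  qed
  have "uniform_structure ?S ?N"
    unfolding uniform_structure_def
  proof (intro conjI)
    show "?N \<noteq> {}" using top by (metis emptyE)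
    show "\<forall>U\<in>?N. Id_on ?S \<subseteq> U \<and> U \<subseteq> ?S \<times> ?S \<and> U\<inverse> \<in> ?N \<and> (\<exists>W\<in>?N. W O W \<subseteq> U)"
    proof (intro ballI conjI)
      fix U assume U: "U \<in> ?N"
      show "Id_on ?S \<subseteq> U" using U by (blast intro: subset_trans)
      show "U \<subseteq> ?S \<times> ?S" using U by (rule CollectE) (rule conjunct1)
      show "U\<inverse> \<in> ?N" by (rule conv[OF U])
      show "\<exists>W\<in>?N. W O W \<subseteq> U" by (rule half[OF U])
    qed
    show "\<forall>U\<in>?N. \<forall>V\<in>?N. U \<inter> V \<in> ?N"
      by (intro ballI inter)
    show "\<forall>U\<in>?N. \<forall>V. U \<subseteq> V \<and> V \<subseteq> ?S \<times> ?S \<longrightarrow> V \<in> ?N"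
    proof (intro ballI allI impI)
      fix U V assume U: "U \<in> ?N" and V: "U \<subseteq> V \<and> V \<subseteq> ?S \<times> ?S"
      obtain M where "openin ?Q M" "Id_on ?S \<subseteq> M" "M \<subseteq> U" using U by blast
      then show "V \<in> ?N" using V by (intro NI[of M]) auto
    qed
  qed
  moreover have "openin Y A \<longleftrightarrow> A \<subseteq> ?S \<and> (\<forall>x\<in>A. \<exists>U\<in>?N. U `` {x} \<subseteq> A)" for A
  proof (intro iffI conjI ballI)
    fix x assume A: "openin Y A" and x: "x \<in> A"
    let ?U = "?S \<times> ?S - {x} \<times> (?S - A)"
    have xS: "x \<in> ?S" using A x openin_subset by blast
    then have "closedin Y {x}" using haus by (simp add: closedin_Hausdorff_singleton)
    moreover have "closedin Y (?S - A)" using A by blast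
    ultimately have "closedin ?Q ({x} \<times> (?S - A))" by (simp add: closedin_prod_Times_iff)
    then have "openin ?Q ?U" using openin_diff[OF openin_topspace, of ?Q] by simp
    then have "?U \<in> ?N" by (rule NI) (use x in auto)
    moreover have "?U `` {x} \<subseteq> A" by auto
    ultimately show "\<exists>U\<in>?N. U `` {x} \<subseteq> A" by (rule bexI[rotated])
  next
    assume R: "A \<subseteq> ?S \<and> (\<forall>x\<in>A. \<exists>U\<in>?N. U `` {x} \<subseteq> A)"
    have "\<exists>B. openin Y B \<and> x \<in> B \<and> B \<subseteq> A" if x: "x \<in> A" for x
    proof -
      obtain U where U: "U \<in> ?N" "U `` {x} \<subseteq> A" using R x by meson
      obtain M where M: "openin ?Q M" "Id_on ?S \<subseteq> M" "M \<subseteq> U" using U by blast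
      have "(x, x) \<in> M" using M(2) R x by blast
      then obtain B C where "openin Y B" "openin Y C" "x \<in> B" "x \<in> C" "B \<times> C \<subseteq> M"
        using M(1) unfolding openin_prod_topology_alt by meson
      then show ?thesis using U(2) M(3) by (intro exI[of _ C]) auto
    qed
    then show "openin Y A" using openin_subopen by blast
  qed (rule openin_subset)
  ultimately show ?thesis unfolding compatible_uniformity_def by blast
qed

theorem ex1_compatible_uniformity:
  assumes "compact_space Y" "Hausdorff_space Y"
  shows "\<exists>!\<U>. compatible_uniformity Y \<U>"
  using compatible_uniformity_diagonal_nbhds[OF assms] compatible_uniformity_eq[OF assms(1)]
  by blast

theorem topological_flow_enveloping:
  fixes act :: "'t::topological_group_add \<Rightarrow> 'x \<Rightarrow> 'x"
  assumes "topological_flow X act"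
  shows "topological_flow (enveloping_space X act) (enveloping_action X act)"
proof -
  let ?S = "topspace X" and ?P = "product_topology (\<lambda>_. X) (topspace X)"
  let ?E = "enveloping_semigroup X act" and ?a = "enveloping_action X act"
  let ?T = "enveloping_space X act"
  let ?R = "range (\<lambda>t. restrict (act t) ?S)"
  have comp: "compact_space X" and haus: "Hausdorff_space X"
    and cont: "continuous_map (prod_topology euclidean X) X (\<lambda>(t, x). act t x)"
    and add: "\<And>s t x. x \<in> ?S \<Longrightarrow> act (s + t) x = act s (act t x)"
    and homeo: "\<And>t. homeomorphic_map X X (act t)"
    using assms unfolding topological_flow_def by auto
  have mem: "act t x \<in> ?S" if "x \<in> ?S" for t x
    using homeomorphic_imp_surjective_map[OF homeo[of t]] that by blast
  have zero: "act 0 x = x" if x: "x \<in> ?S" for x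
  proof -
    have "act 0 (act 0 x) = act 0 x" using add[OF x, of 0 0] by simp
    then show ?thesis
      using homeomorphic_imp_injective_map[OF homeo[of 0]] mem x by (meson inj_onD)
  qed
  have topP: "topspace ?P = PiE ?S (\<lambda>_. ?S)" by simp
  have ES: "?E \<subseteq> topspace ?P"
    unfolding enveloping_semigroup_def by (rule closure_of_subset_topspace)
  have topT: "topspace ?T = ?E"
    unfolding enveloping_space_def using ES by (metis topspace_subtopology_subset)
  have closE: "closedin ?P ?E"
    unfolding enveloping_semigroup_def by (rule closedin_closure_of)
  have compP: "compact_space ?P" using comp by (simp add: compact_space_product_topology)
  have compT: "compact_space ?T"
    unfolding enveloping_space_def
    using closE compP closedin_compact_space compact_space_subtopology by blast
  have hausT: "Hausdorff_space ?T"
    unfolding enveloping_space_def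
    using haus by (simp add: Hausdorff_space_product_topology Hausdorff_space_subtopology)
  have joint: "continuous_map (prod_topology euclidean ?P) ?P (\<lambda>(t, p). ?a t p)"
    unfolding continuous_map_componentwise
  proof (intro conjI ballI)
    show "(\<lambda>(t, p). ?a t p) ` topspace (prod_topology euclidean ?P) \<subseteq> extensional ?S"
      by (auto simp: enveloping_action_def)
  next
    fix x assume x: "x \<in> ?S"
    have p: "continuous_map (prod_topology euclidean ?P) X (\<lambda>u. snd u x)"
      using continuous_map_compose[OF continuous_map_snd continuous_map_product_projection[OF x]]
      by (simp add: o_def)
    have "continuous_map (prod_topology euclidean ?P) (prod_topology euclidean X)
            (\<lambda>u. (fst u, snd u x))"
      using p by (simp add: continuous_map_paired continuous_map_fst)
    from continuous_map_compose[OF this cont]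
    show "continuous_map (prod_topology euclidean ?P) X (\<lambda>u. (case u of (t, p) \<Rightarrow> ?a t p) x)"
      using x by (simp add: o_def enveloping_action_def compose_def case_prod_unfold)
  qed
  have sep: "continuous_map ?P ?P (?a t)" for t
  proof -
    have "continuous_map ?P (prod_topology euclidean ?P) (\<lambda>p. (t, p))"
      by (simp add: continuous_map_paired)
    from continuous_map_compose[OF this joint] show ?thesis by (simp add: o_def)
  qed
  have stable: "?a t p \<in> ?E" if p: "p \<in> ?E" for t p
  proof -
    have "?a t ` ?R \<subseteq> ?R"
    proof clarify
      fix s
      have "?a t (restrict (act s) ?S) = restrict (act (t + s)) ?S"
        by (auto simp: enveloping_action_def compose_def add)
      then show "?a t (restrict (act s) ?S) \<in> ?R" by blast
    qed
    then have "?a t ` (?P closure_of ?R) \<subseteq> ?P closure_of ?R"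
      using continuous_map_image_closure_subset[OF sep, of t ?R] closure_of_mono
      by (meson subset_trans)
    then show ?thesis using p unfolding enveloping_semigroup_def by blast
  qed
  have "prod_topology euclidean ?T = subtopology (prod_topology euclidean ?P) (UNIV \<times> ?E)"
    unfolding enveloping_space_def by (simp add: prod_topology_subtopology)
  then have "continuous_map (prod_topology euclidean ?T) ?P (\<lambda>(t, p). ?a t p)"
    by (metis continuous_map_from_subtopology joint)
  moreover have "(\<lambda>(t, p). ?a t p) \<in> topspace (prod_topology euclidean ?T) \<rightarrow> ?E"
    using stable by (auto simp: topT)
  ultimately have "continuous_map (prod_topology euclidean ?T) (subtopology ?P ?E) (\<lambda>(t, p). ?a t p)"
    by (simp add: continuous_map_in_subtopology image_subset_iff_funcset)
  then have contT: "continuous_map (prod_topology euclidean ?T) ?T (\<lambda>(t, p). ?a t p)"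
    by (simp only: enveloping_space_def)
  have addT: "?a (s + t) p = ?a s (?a t p)" if p: "p \<in> ?E" for s t p
  proof -
    have "p x \<in> ?S" if "x \<in> ?S" for x using ES p that by (auto simp: PiE_def Pi_def)
    then show ?thesis by (auto simp: enveloping_action_def compose_def add fun_eq_iff)
  qed
  have zeroT: "?a 0 p = p" if p: "p \<in> ?E" for p
  proof -
    have "p \<in> PiE ?S (\<lambda>_. ?S)" using ES p by auto
    then show ?thesis
      by (auto simp: enveloping_action_def compose_def zero fun_eq_iff PiE_def Pi_def
          extensional_def)
  qed
  have contt: "continuous_map ?T ?T (?a t)" for t
  proof -
    have "continuous_map ?T (prod_topology euclidean ?T) (\<lambda>p. (t, p))"
      by (simp add: continuous_map_paired)
    from continuous_map_compose[OF this contT] show ?thesis by (simp add: o_def)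
  qed
  have "homeomorphic_map ?T ?T (?a t)" for t
  proof -
    have "homeomorphic_maps ?T ?T (?a t) (?a (- t))"
      unfolding homeomorphic_maps_def
      using contt addT[symmetric] zeroT by (simp add: topT)
    then show ?thesis by (rule homeomorphic_maps_map[THEN iffD1, THEN conjunct1])
  qed
  then show ?thesis
    unfolding topological_flow_def using compT hausT contT addT by (simp add: topT)
qed

end

theory Submission
  imports Defs
begin

text \<open>The evaluations \<open>p \<mapsto> p x\<close> are equivariant continuous maps from \<open>E(X)\<close> to \<open>X\<close>, and they
  separate the points of \<open>E(X)\<close>. By compactness, equicontinuity is inherited along a family of
  equivariant maps that separates points, which gives the first claim. If \<open>x\<close> has a dense orbit, the
  evaluation at \<open>x\<close> has a compact dense image, so that \<open>X\<close> is a factor of \<open>E(X)\<close>; factor maps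
  of compact flows are closed and therefore preserve equicontinuity.\<close>

lemma uniformity_of_eq:
  assumes "compact_space Y" "Hausdorff_space Y"
  shows "uniformity_of Y = {U. U \<subseteq> topspace Y \<times> topspace Y \<and>
           (\<exists>M. openin (prod_topology Y Y) M \<and> Id_on (topspace Y) \<subseteq> M \<and> M \<subseteq> U)}"
  unfolding uniformity_of_def
  by (rule the1_equality[OF ex1_compatible_uniformity[OF assms]
        compatible_uniformity_diagonal_nbhds[OF assms]])

text \<open>Open neighbourhoods of the diagonal form a base of the uniformity, and the sections of
  entourages at \<open>x\<close> form a neighbourhood base there. Both quantifiers over entourages
  can thus be traded for open sets, which pull back along continuous maps.\<close>

lemma equicontinuous_at_iff_nbhd:
  assumes comp: "compact_space Y" and haus: "Hausdorff_space Y" and x: "x \<in> topspace Y"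
  shows "equicontinuous_at Y act x \<longleftrightarrow>
    (\<forall>M. openin (prod_topology Y Y) M \<and> Id_on (topspace Y) \<subseteq> M \<longrightarrow>
       (\<exists>N. openin Y N \<and> x \<in> N \<and> (\<forall>y\<in>N. \<forall>t. (act t x, act t y) \<in> M)))"
    (is "?L \<longleftrightarrow> ?R")
proof -
  have cu: "compatible_uniformity Y (uniformity_of Y)"
    unfolding uniformity_of_eq[OF comp haus] by (rule compatible_uniformity_diagonal_nbhds[OF comp haus])
  show ?thesis
  proof
    assume L: ?L
    show ?R
    proof (intro allI impI, elim conjE)
      fix M assume M: "openin (prod_topology Y Y) M" "Id_on (topspace Y) \<subseteq> M"
      have "M \<in> uniformity_of Y"
        using M openin_subset[OF M(1)] unfolding uniformity_of_eq[OF comp haus] by auto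
      with L obtain U where U: "U \<in> uniformity_of Y"
        "\<forall>y. (x, y) \<in> U \<longrightarrow> (\<forall>t. (act t x, act t y) \<in> M)"
        unfolding equicontinuous_at_def by meson
      obtain N where "openin Y N" "x \<in> N" "N \<subseteq> U `` {x}"
        by (rule compatible_uniformity_nbhd[OF cu U(1) x])
      then show "\<exists>N. openin Y N \<and> x \<in> N \<and> (\<forall>y\<in>N. \<forall>t. (act t x, act t y) \<in> M)"
        using U(2) by blast
    qed
  next
    assume R: ?R
    show ?L
      unfolding equicontinuous_at_def
    proof
      fix V assume "V \<in> uniformity_of Y"
      then obtain M where M: "openin (prod_topology Y Y) M" "Id_on (topspace Y) \<subseteq> M" "M \<subseteq> V"
        unfolding uniformity_of_eq[OF comp haus] by blast
      then obtain N where N: "openin Y N" "x \<in> N" "\<forall>y\<in>N. \<forall>t. (act t x, act t y) \<in> M"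
        using R by meson
      \<comment> \<open>The openness clause of compatibility turns the neighbourhood
        \<open>N\<close> back into an entourage whose section at \<open>x\<close> lies in
        \<open>N\<close>.\<close>
      then obtain U where "U \<in> uniformity_of Y" "U `` {x} \<subseteq> N"
        using cu unfolding compatible_uniformity_def by meson
      then show "\<exists>U\<in>uniformity_of Y. \<forall>y. (x, y) \<in> U \<longrightarrow> (\<forall>t. (act t x, act t y) \<in> V)"
        using N(3) M(3) by (intro bexI[of _ U]) auto
    qed
  qed
qed

text \<open>The square of a compact Hausdorff space is regular and its diagonal is closed, so a
  point off the diagonal can be separated from the whole diagonal by open sets.\<close>

lemma diagonal_nbhd_separation:
  assumes comp: "compact_space X" and haus: "Hausdorff_space X"
    and ab: "a \<in> topspace X" "b \<in> topspace X" "a \<noteq> b"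
  obtains G W where "openin (prod_topology X X) G" "(a, b) \<in> G"
    "openin (prod_topology X X) W" "Id_on (topspace X) \<subseteq> W" "G \<inter> W = {}"
proof -
  have "regular_space (prod_topology X X)"
    using compact_Hausdorff_imp_regular_space[OF comp haus] by (simp add: regular_space_prod_topology)
  moreover have "closedin (prod_topology X X) (Id_on (topspace X))"
  proof -
    have "Id_on (topspace X) = (\<lambda>x. (x, x)) ` topspace X" by auto
    then show ?thesis using haus by (simp add: Hausdorff_space_closedin_diagonal)
  qed
  moreover have "(a, b) \<in> topspace (prod_topology X X) - Id_on (topspace X)" using ab by auto
  ultimately show thesis
    using that unfolding regular_space_def disjnt_def by meson
qed

lemma openin_preimage_prod_map:
  assumes "continuous_map Y X f" "openin (prod_topology X X) G"
  shows "openin (prod_topology Y Y) {(p, q) \<in> topspace Y \<times> topspace Y. (f p, f q) \<in> G}"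
proof -
  have "continuous_map (prod_topology Y Y) (prod_topology X X) (\<lambda>(p, q). (f p, f q))"
    using assms(1) by (simp add: continuous_map_prod_top)
  from openin_continuous_map_preimage[OF this assms(2)] show ?thesis
    by (rule back_subst[of "openin _"]) auto
qed

text \<open>Off-diagonal pairs are told apart by some \<open>f i\<close>, and the complement of a
  diagonal neighbourhood is compact. Finitely many indices therefore suffice to force orbit pairs
  into that neighbourhood, and finitely many equicontinuity conditions can be met
  simultaneously.\<close>

lemma equicontinuous_at_separating_family:
  assumes Y: "compact_space Y" "Hausdorff_space Y" and X: "compact_space X" "Hausdorff_space X"
    and cont: "\<And>i. i \<in> I \<Longrightarrow> continuous_map Y X (f i)"
    and sep: "\<And>p q. \<lbrakk>p \<in> topspace Y; q \<in> topspace Y; \<And>i. i \<in> I \<Longrightarrow> f i p = f i q\<rbrakk> \<Longrightarrow> p = q"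
    and act: "\<And>t p. p \<in> topspace Y \<Longrightarrow> actY t p \<in> topspace Y"
    and equivariant: "\<And>i t p. \<lbrakk>i \<in> I; p \<in> topspace Y\<rbrakk> \<Longrightarrow> f i (actY t p) = actX t (f i p)"
    and p: "p \<in> topspace Y" and eq: "\<And>i. i \<in> I \<Longrightarrow> equicontinuous_at X actX (f i p)"
  shows "equicontinuous_at Y actY p"
  unfolding equicontinuous_at_iff_nbhd[OF Y p]
proof (intro allI impI, elim conjE)
  let ?YY = "prod_topology Y Y" and ?XX = "prod_topology X X"
  fix M assume M: "openin ?YY M" "Id_on (topspace Y) \<subseteq> M"
  let ?K = "topspace Y \<times> topspace Y - M"
  define P where "P i G = {(p, q) \<in> topspace Y \<times> topspace Y. (f i p, f i q) \<in> G}" for i G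
  have fX: "f i q \<in> topspace X" if "i \<in> I" "q \<in> topspace Y" for i q
    using continuous_map_image_subset_topspace[OF cont[OF that(1)]] that(2) by blast
  \<comment> \<open>\<open>G\<close> surrounds the image of \<open>k\<close> under an
    \<open>f i\<close> separating its two entries. A pair whose image lies in the diagonal
    neighbourhood \<open>W\<close> then avoids \<open>P i G\<close>, the part of the cover belonging
    to \<open>k\<close>.\<close>
  have "\<exists>i G W. i \<in> I \<and> openin ?XX G \<and> k \<in> P i G \<and>
      openin ?XX W \<and> Id_on (topspace X) \<subseteq> W \<and> G \<inter> W = {}" if k: "k \<in> ?K" for k
  proof -
    obtain a b where ab: "k = (a, b)" "a \<in> topspace Y" "b \<in> topspace Y" "a \<noteq> b"
      using k M(2) by (cases k) (auto simp: Id_on_def)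
    then obtain i where i: "i \<in> I" "f i a \<noteq> f i b" using sep by blast
    obtain G W where "openin ?XX G" "(f i a, f i b) \<in> G"
      "openin ?XX W" "Id_on (topspace X) \<subseteq> W" "G \<inter> W = {}"
      by (rule diagonal_nbhd_separation[OF X fX[OF i(1) ab(2)] fX[OF i(1) ab(3)] i(2)])
    then show ?thesis using ab i by (intro exI[of _ i] exI[of _ G] exI[of _ W]) (auto simp: P_def)
  qed
  then obtain i G W where iGW: "\<And>k. k \<in> ?K \<Longrightarrow> i k \<in> I \<and> openin ?XX (G k) \<and> k \<in> P (i k) (G k) \<and>
      openin ?XX (W k) \<and> Id_on (topspace X) \<subseteq> W k \<and> G k \<inter> W k = {}"
    by metis
  have "closedin ?YY ?K" using M(1) closedin_diff[OF closedin_topspace, of ?YY] by simp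
  moreover have "compact_space ?YY" using Y by (simp add: compact_space_prod_topology)
  ultimately have "compactin ?YY ?K" by (rule closedin_compact_space[rotated])
  moreover have "openin ?YY U" if "U \<in> (\<lambda>k. P (i k) (G k)) ` ?K" for U
    using that iGW cont openin_preimage_prod_map unfolding P_def by blast
  moreover have "?K \<subseteq> \<Union> ((\<lambda>k. P (i k) (G k)) ` ?K)" using iGW by (meson UN_iff subsetI)
  ultimately obtain \<F> where \<F>: "finite \<F>" "\<F> \<subseteq> (\<lambda>k. P (i k) (G k)) ` ?K" "?K \<subseteq> \<Union>\<F>"
    using compactinD[of ?YY ?K] by meson
  obtain F where F: "F \<subseteq> ?K" "finite F" "\<F> = (\<lambda>k. P (i k) (G k)) ` F"
    using finite_subset_image[OF \<F>(1,2)] by (elim exE conjE)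
  \<comment> \<open>Equicontinuity at \<open>f (i k) p\<close> is applied with target
    \<open>W k\<close>, once for each of the finitely many \<open>k\<close> in the subcover.\<close>
  have "\<exists>N. openin X N \<and> f (i k) p \<in> N \<and> (\<forall>y\<in>N. \<forall>t. (actX t (f (i k) p), actX t y) \<in> W k)"
    if "k \<in> F" for k
  proof -
    have k: "i k \<in> I" "openin ?XX (W k)" "Id_on (topspace X) \<subseteq> W k"
      using iGW F(1) that by blast+
    show ?thesis
      using eq[OF k(1)] k(2,3) unfolding equicontinuous_at_iff_nbhd[OF X fX[OF k(1) p]] by meson
  qed
  then obtain N where N: "\<And>k. k \<in> F \<Longrightarrow> openin X (N k) \<and> f (i k) p \<in> N k \<and>
      (\<forall>y\<in>N k. \<forall>t. (actX t (f (i k) p), actX t y) \<in> W k)"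
    by metis
  \<comment> \<open>The final intersection with \<open>topspace Y\<close> matters when
    \<open>F\<close> is empty, where the indexed intersection would be the whole type.\<close>
  let ?N = "(\<Inter>k\<in>F. {q \<in> topspace Y. f (i k) q \<in> N k}) \<inter> topspace Y"
  have "openin Y {q \<in> topspace Y. f (i k) q \<in> N k}" if "k \<in> F" for k
  proof -
    have "i k \<in> I" using iGW F(1) that by blast
    then show ?thesis using openin_continuous_map_preimage cont N[OF that] by blast
  qed
  then have "openin Y ?N" by (rule openin_INT[OF F(2)])
  moreover have "p \<in> ?N" using N p by simp
  moreover have "(actY t p, actY t q) \<in> M" if q: "q \<in> ?N" for q t
  proof (rule ccontr)
    assume nM: "(actY t p, actY t q) \<notin> M"
    have qY: "q \<in> topspace Y" using q by simp
    with nM have "(actY t p, actY t q) \<in> ?K" using act p by simp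
    \<comment> \<open>A pair outside \<open>M\<close> falls into a member of the finite cover, so
      its image is in \<open>G k\<close>. Equivariance and the choice of \<open>N k\<close> put the
      same image in \<open>W k\<close>, which is disjoint from \<open>G k\<close>.\<close>
    then obtain k where k: "k \<in> F" "(f (i k) (actY t p), f (i k) (actY t q)) \<in> G k"
      using \<F>(3) F(3) by (auto simp: P_def)
    have kI: "i k \<in> I" "G k \<inter> W k = {}" using iGW F(1) k(1) by blast+
    have "f (i k) q \<in> N k" using q k(1) by simp
    then have "(f (i k) (actY t p), f (i k) (actY t q)) \<in> W k"
      using N[OF k(1)] equivariant[OF kI(1)] p qY by simp
    then show False using k(2) kI(2) by blast
  qed
  ultimately show "\<exists>N. openin Y N \<and> p \<in> N \<and> (\<forall>q\<in>N. \<forall>t. (actY t p, actY t q) \<in> M)"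
    by meson
qed

text \<open>Equicontinuity at all points of the fibre over \<open>x\<close> gives an open set around
  that fibre. Since \<open>f\<close> is closed, this set contains the preimage of a neighbourhood of
  \<open>x\<close>, and that neighbourhood witnesses equicontinuity at \<open>x\<close>.\<close>

lemma equicontinuous_flow_factor:
  assumes Y: "compact_space Y" "Hausdorff_space Y" and X: "compact_space X" "Hausdorff_space X"
    and cont: "continuous_map Y X f" and surj: "f ` topspace Y = topspace X"
    and equivariant: "\<And>t p. p \<in> topspace Y \<Longrightarrow> f (actY t p) = actX t (f p)"
    and act: "\<And>t p. p \<in> topspace Y \<Longrightarrow> actY t p \<in> topspace Y"
    and eq: "equicontinuous_flow Y actY"
  shows "equicontinuous_flow X actX"
  unfolding equicontinuous_flow_def
proof
  fix x assume x: "x \<in> topspace X"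
  show "equicontinuous_at X actX x"
    unfolding equicontinuous_at_iff_nbhd[OF X x]
  proof (intro allI impI, elim conjE)
    fix M assume M: "openin (prod_topology X X) M" "Id_on (topspace X) \<subseteq> M"
    define M' where "M' = {(p, q) \<in> topspace Y \<times> topspace Y. (f p, f q) \<in> M}"
    have "openin (prod_topology Y Y) M'" unfolding M'_def by (rule openin_preimage_prod_map[OF cont M(1)])
    moreover have "Id_on (topspace Y) \<subseteq> M'" using M(2) surj by (auto simp: M'_def)
    moreover have "equicontinuous_at Y actY p" if "p \<in> topspace Y" for p
      using eq that unfolding equicontinuous_flow_def by simp
    ultimately have "\<exists>N. openin Y N \<and> p \<in> N \<and> (\<forall>q\<in>N. \<forall>t. (actY t p, actY t q) \<in> M')"
      if "p \<in> topspace Y" for p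
      using equicontinuous_at_iff_nbhd[OF Y that] that by blast
    then obtain N where N: "\<And>p. p \<in> topspace Y \<Longrightarrow>
        openin Y (N p) \<and> p \<in> N p \<and> (\<forall>q\<in>N p. \<forall>t. (actY t p, actY t q) \<in> M')"
      by metis
    \<comment> \<open>A single point over \<open>x\<close> would not do: points near
      \<open>x\<close> may have all their preimages far from it, so the neighbourhoods of the entire
      fibre are united.\<close>
    let ?fib = "{p \<in> topspace Y. f p = x}"
    have "openin Y (\<Union>p\<in>?fib. N p)" using N by auto
    moreover have "?fib \<subseteq> (\<Union>p\<in>?fib. N p)" using N by blast
    moreover have "closed_map Y X f" by (rule continuous_imp_closed_map[OF cont Y(1) X(2)])
    ultimately obtain V where V: "openin X V" "x \<in> V" "{q \<in> topspace Y. f q \<in> V} \<subseteq> (\<Union>p\<in>?fib. N p)"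
      using x unfolding closed_map_fibre_neighbourhood by meson
    have "(actX t x, actX t y) \<in> M" if y: "y \<in> V" for y t
    proof -
      have "y \<in> topspace X" using openin_subset[OF V(1)] y by blast
      then obtain q where q: "q \<in> topspace Y" "y = f q" using surj by auto
      then have "q \<in> (\<Union>p\<in>?fib. N p)" using V(3) y by blast
      \<comment> \<open>The point \<open>p\<close> depends on \<open>y\<close>, but always lies over
        \<open>x\<close>; hence applying \<open>f\<close> to the pair from \<open>M'\<close> gives
        exactly the required pair in \<open>M\<close>.\<close>
      then obtain p where p: "p \<in> topspace Y" "f p = x" "q \<in> N p" by blast
      then have "(actY t p, actY t q) \<in> M'" using N by blast
      then show ?thesis using equivariant p(1,2) q by (simp add: M'_def)
    qed
    with V(1,2) show "\<exists>N. openin X N \<and> x \<in> N \<and> (\<forall>y\<in>N. \<forall>t. (actX t x, actX t y) \<in> M)"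
      by blast
  qed
qed

theorem theorem3:
  fixes X :: "'x topology"
    and act :: "'t::topological_group_add \<Rightarrow> 'x \<Rightarrow> 'x"
  assumes "topological_flow X act"
    and "\<forall>x\<in>topspace X. \<not> openin X {x}"
  shows "(equicontinuous_flow X act \<longrightarrow>
            equicontinuous_flow (enveloping_space X act) (enveloping_action X act)) \<and>
         (point_transitive X act \<longrightarrow>
            equicontinuous_flow (enveloping_space X act) (enveloping_action X act) \<longrightarrow>
            equicontinuous_flow X act)"
proof -
  let ?E = "enveloping_space X act" and ?a = "enveloping_action X act"
  let ?P = "product_topology (\<lambda>_. X) (topspace X)"
  let ?R = "range (\<lambda>t. restrict (act t) (topspace X))"
  note flowE = topological_flow_enveloping[OF assms(1)]
  have X: "compact_space X" "Hausdorff_space X" and E: "compact_space ?E" "Hausdorff_space ?E"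
    using assms(1) flowE unfolding topological_flow_def by auto
  have actX: "act t x \<in> topspace X" if "x \<in> topspace X" for t x
    using assms(1) that homeomorphic_imp_surjective_map unfolding topological_flow_def by blast
  have actE: "?a t p \<in> topspace ?E" if "p \<in> topspace ?E" for t p
    using flowE that homeomorphic_imp_surjective_map unfolding topological_flow_def by blast
  have topE: "topspace ?E \<subseteq> PiE (topspace X) (\<lambda>_. topspace X)"
    unfolding enveloping_space_def by auto
  have cont: "continuous_map ?E X (\<lambda>p. p x)" if "x \<in> topspace X" for x
    unfolding enveloping_space_def
    by (rule continuous_map_from_subtopology[OF continuous_map_product_projection[OF that]])
  have equivariant: "?a t p x = act t (p x)" if "x \<in> topspace X" for t p x
    using that by (simp add: enveloping_action_def compose_def)
  have "equicontinuous_flow ?E ?a" if eq: "equicontinuous_flow X act"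
    unfolding equicontinuous_flow_def
  proof
    fix p assume p: "p \<in> topspace ?E"
    show "equicontinuous_at ?E ?a p"
    proof (rule equicontinuous_at_separating_family[OF E X, where f = "\<lambda>x p. p x" and I = "topspace X"])
      \<comment> \<open>Members of \<open>PiE\<close> are extensional, so agreement on
        \<open>topspace X\<close> already makes them equal as functions.\<close>
      show "q = r" if "q \<in> topspace ?E" "r \<in> topspace ?E" "\<And>x. x \<in> topspace X \<Longrightarrow> q x = r x" for q r
        using PiE_ext[OF subsetD[OF topE that(1)] subsetD[OF topE that(2)] that(3)] .
      show "equicontinuous_at X act (p x)" if "x \<in> topspace X" for x
        using eq p topE that unfolding equicontinuous_flow_def by (auto simp: PiE_def Pi_def)
    qed (use p cont actE equivariant in auto)
  qed
  moreover have "equicontinuous_flow X act"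
    if pt: "point_transitive X act" and eq: "equicontinuous_flow ?E ?a"
  proof -
    obtain x where x: "x \<in> topspace X" and dense: "X closure_of (range (\<lambda>t. act t x)) = topspace X"
      using pt unfolding point_transitive_def by blast
    have "?R \<subseteq> topspace ?P" using actX by (auto simp: PiE_def Pi_def)
    then have "?R \<subseteq> topspace ?E"
      unfolding enveloping_space_def enveloping_semigroup_def
      using closure_of_subset[of ?R ?P] by auto
    \<comment> \<open>Evaluation at \<open>x\<close> carries the translations in \<open>?R\<close>
      onto the orbit of \<open>x\<close>, so its image, closed by compactness, contains a dense
      set.\<close>
    then have "(\<lambda>p. p x) ` ?R \<subseteq> (\<lambda>p. p x) ` topspace ?E" by (rule image_mono)
    then have "range (\<lambda>t. act t x) \<subseteq> (\<lambda>p. p x) ` topspace ?E"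
      using x by (simp add: image_image)
    moreover have "closedin X ((\<lambda>p. p x) ` topspace ?E)"
      using continuous_imp_closed_map[OF cont[OF x] E(1) X(2)] unfolding closed_map_def by blast
    ultimately have "topspace X \<subseteq> (\<lambda>p. p x) ` topspace ?E"
      using closure_of_minimal dense by metis
    moreover have "(\<lambda>p. p x) ` topspace ?E \<subseteq> topspace X"
      using topE x by (auto simp: PiE_def Pi_def)
    ultimately have "(\<lambda>p. p x) ` topspace ?E = topspace X" by (rule subset_antisym[rotated])
    from equicontinuous_flow_factor[OF E X cont[OF x] this equivariant[OF x] actE eq]
    show ?thesis .
  qed
  ultimately show ?thesis by blast
qed

end
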